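(* Let $t\geq 4$. There exists $r_t\geq\binom{t}{2}$ such that for all $r\geq r_t$, $K_t$ is $r$-rainbow-uncommon.
   Context: All graphs are simple. A copy of a graph $H$ in a graph $G$ is a subgraph of $G$ isomorphic to $H$. An $r$-coloring of a set $X$ is a surjective function $c:X\to\{1,\dots,r\}$. Under an edge-coloring of $G$, a subgraph $H$ is rainbow if all edges of $H$ receive pairwise distinct colors. For a graph $H$ with $e$ edges, let $M_{\mathrm{rb}}(H;n,r)$ be the maximum, over all $r$-colorings of $E(K_n)$, of the number of rainbow copies of $H$ in $K_n$; let $m_{\mathrm{rb}}(H;n,r)=M_{\mathrm{rb}}(H;n,r)/(\text{number of copies of } H \text{ in } K_n)$ and $m_{\mathrm{rb}}(H;r)=\lim_{n\to\infty} m_{\mathrm{rb}}(H;n,r)$ (this limit exists). $H$ is called $r$-rainbow-common if $m_{\mathrm{rb}}(H;r)=\binom{r}{e}e!/r^e$, and $r$-rainbow-uncommon otherwise. *)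

theory Defs
  imports Complex_Main
begin

type_synonym 'a ugraph = "'a set \<times> 'a set set"

abbreviation verts :: "'a ugraph \<Rightarrow> 'a set" where
  "verts G \<equiv> fst G"

abbreviation edges :: "'a ugraph \<Rightarrow> 'a set set" where
  "edges G \<equiv> snd G"

definition simple_graph :: "'a ugraph \<Rightarrow> bool" where
  "simple_graph G \<longleftrightarrow> finite (verts G) \<and> (\<forall>e\<in>edges G. e \<subseteq> verts G \<and> card e = 2)"

definition complete_graph :: "nat \<Rightarrow> nat ugraph" where
  "complete_graph n = ({1..n}, {e. e \<subseteq> {1..n} \<and> card e = 2})"

definition subgraph :: "'a ugraph \<Rightarrow> 'a ugraph \<Rightarrow> bool" where
  "subgraph F G \<longleftrightarrow> simple_graph F \<and> verts F \<subseteq> verts G \<and> edges F \<subseteq> edges G"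

definition isomorphic :: "'a ugraph \<Rightarrow> 'b ugraph \<Rightarrow> bool" where
  "isomorphic G H \<longleftrightarrow> (\<exists>f. bij_betw f (verts G) (verts H) \<and>
     (\<forall>u\<in>verts G. \<forall>v\<in>verts G. {u, v} \<in> edges G \<longleftrightarrow> {f u, f v} \<in> edges H))"

definition copies :: "'a ugraph \<Rightarrow> 'b ugraph \<Rightarrow> 'b ugraph set" where
  "copies H G = {F. subgraph F G \<and> isomorphic F H}"

text \<open>Colorings are total functions; only their values on \<open>X\<close> matter.\<close>

definition coloring :: "nat \<Rightarrow> 'x set \<Rightarrow> ('x \<Rightarrow> nat) \<Rightarrow> bool" where
  "coloring r X c \<longleftrightarrow> c ` X = {1..r}"

definition rainbow :: "('a set \<Rightarrow> nat) \<Rightarrow> 'a ugraph \<Rightarrow> bool" where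
  "rainbow c F \<longleftrightarrow> inj_on c (edges F)"

definition rainbow_copies :: "('b set \<Rightarrow> nat) \<Rightarrow> 'a ugraph \<Rightarrow> 'b ugraph \<Rightarrow> 'b ugraph set" where
  "rainbow_copies c H G = {F \<in> copies H G. rainbow c F}"

text \<open>The maximum is over a finite set. That set is nonempty, and hence the value meaningful,
  exactly when \<open>K\<^sub>n\<close> has an \<open>r\<close>-coloring; for \<open>r \<ge> 1\<close> this is the case for all large \<open>n\<close>.\<close>

definition max_rainbow :: "'a ugraph \<Rightarrow> nat \<Rightarrow> nat \<Rightarrow> nat" where
  "max_rainbow H n r =
     Max {card (rainbow_copies c H (complete_graph n)) | c.
            coloring r (edges (complete_graph n)) c}"

definition max_rainbow_density :: "'a ugraph \<Rightarrow> nat \<Rightarrow> nat \<Rightarrow> real" where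
  "max_rainbow_density H n r =
     real (max_rainbow H n r) / real (card (copies H (complete_graph n)))"

definition limit_rainbow_density :: "'a ugraph \<Rightarrow> nat \<Rightarrow> real" where
  "limit_rainbow_density H r = lim (\<lambda>n. max_rainbow_density H n r)"

definition rainbow_common :: "nat \<Rightarrow> 'a ugraph \<Rightarrow> bool" where
  "rainbow_common r H \<longleftrightarrow>
     limit_rainbow_density H r =
       real (r choose card (edges H)) * fact (card (edges H)) / real r ^ card (edges H)"

definition rainbow_uncommon :: "nat \<Rightarrow> 'a ugraph \<Rightarrow> bool" where
  "rainbow_uncommon r H \<longleftrightarrow> \<not> rainbow_common r H"

lemma finite_edges_complete_graph: "finite (edges (complete_graph n))"
  by (rule finite_subset[of _ "Pow {1..n}"]) (auto simp: complete_graph_def)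

lemma finite_copies_complete_graph: "finite (copies H (complete_graph n))"
proof (rule finite_subset)
  show "copies H (complete_graph n) \<subseteq> Pow {1..n} \<times> Pow (edges (complete_graph n))"
    by (auto simp: copies_def subgraph_def complete_graph_def)
  show "finite (Pow {1..n} \<times> Pow (edges (complete_graph n)))"
    using finite_edges_complete_graph by simp
qed

lemma finite_rainbow_counts:
  "finite {card (rainbow_copies c H (complete_graph n)) | c.
             coloring r (edges (complete_graph n)) c}"
proof (rule finite_subset)
  show "{card (rainbow_copies c H (complete_graph n)) | c.
           coloring r (edges (complete_graph n)) c} \<subseteq> {..card (copies H (complete_graph n))}"
    by (auto simp: rainbow_copies_def intro!: card_mono finite_copies_complete_graph)
qed simp

lemma card_edges_complete_graph: "card (edges (complete_graph n)) = n choose 2"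
  by (simp add: complete_graph_def n_subsets)

lemma ex_coloring_complete_graph:
  assumes "1 \<le> r" "r \<le> n choose 2"
  shows "\<exists>c. coloring r (edges (complete_graph n)) c"
proof -
  obtain h where h: "bij_betw h (edges (complete_graph n)) {0..<n choose 2}"
    using ex_bij_betw_finite_nat[OF finite_edges_complete_graph[of n]]
    by (auto simp: card_edges_complete_graph)
  have "(\<lambda>i. min (Suc i) r) ` {0..<n choose 2} = {1..r}"
  proof (intro set_eqI iffI)
    fix x assume "x \<in> {1..r}"
    then show "x \<in> (\<lambda>i. min (Suc i) r) ` {0..<n choose 2}"
      using assms by (intro image_eqI[of _ _ "x - 1"]) auto
  qed (use assms in auto)
  then have "(\<lambda>e. min (Suc (h e)) r) ` edges (complete_graph n) = {1..r}"
    using h by (simp add: bij_betw_def flip: image_image[of "\<lambda>i. min (Suc i) r" h])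
  then show ?thesis by (auto simp: coloring_def)
qed

end

theory Submission
  imports Defs "HOL-Library.FuncSet" "HOL-Number_Theory.Cong"
begin

text \<open>Color the edge \<open>xy\<close> of \<open>K\<^sub>n\<close> by \<open>x + y\<close> modulo \<open>r\<close> and choose the vertices \<open>f 0, \<dots>, f (t - 1)\<close>
  at random. Any given two edges of \<open>K\<^sub>t\<close> get the same color with probability at most \<open>1/r + 1/n\<close>.
  Two edges \<open>ik\<close> and \<open>jk\<close> collide exactly when \<open>f i \<equiv> f j\<close>, whatever \<open>k\<close> is, so for \<open>t \<ge> 4\<close> some of
  the \<open>s\<close> collision events coincide (\<open>s\<close> is the number of pairs of edges of \<open>K\<^sub>t\<close>), and the limiting
  rainbow density is at least \<open>1 - (s - 1)/r\<close>. The uniformly random coloring only achieves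
  \<open>\<Prod>i<e. (1 - i/r) \<le> r / (r + s)\<close>, which is smaller as soon as \<open>r > s (s - 1)\<close>.

  The limit exists because dropping the surjectivity of the colorings makes the density decreasing in
  \<open>n\<close> (average over the deleted vertex) and does not change it asymptotically: \<open>r + 1\<close> additional
  vertices suffice to make a coloring surjective.\<close>

section \<open>Copies of complete graphs as vertex sets\<close>

text \<open>Polymorphic because it serves twice: \<open>pairs S\<close> is the edge set of the
  complete graph on \<open>S\<close>, and \<open>pairs (pairs {..<t})\<close> indexes the possible
  collisions of two edges.\<close>

definition pairs :: "'a set \<Rightarrow> 'a set set" where
  "pairs S = {e. e \<subseteq> S \<and> card e = 2}"

text \<open>The vertex sets of the rainbow copies of \<open>K_t\<close>. The ground set is
  arbitrary, so that vertices can later be deleted, added and relabelled.\<close>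

definition rainbow_sets :: "nat \<Rightarrow> ('a set \<Rightarrow> 'b) \<Rightarrow> 'a set \<Rightarrow> 'a set set" where
  "rainbow_sets t c A = {S. S \<subseteq> A \<and> card S = t \<and> inj_on c (pairs S)}"

lemma edges_complete_graph: "edges (complete_graph n) = pairs {1..n}"
  by (simp add: complete_graph_def pairs_def)

lemma finite_pairs: "finite S \<Longrightarrow> finite (pairs S)"
  by (simp add: pairs_def)

lemma pairs_mono: "S \<subseteq> T \<Longrightarrow> pairs S \<subseteq> pairs T"
  by (auto simp: pairs_def)

lemma insert_in_pairs_iff: "{u, v} \<in> pairs S \<longleftrightarrow> u \<in> S \<and> v \<in> S \<and> u \<noteq> v"
  by (cases "u = v") (auto simp: pairs_def)

lemma card_pairs: "finite S \<Longrightarrow> card (pairs S) = card S choose 2"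
  by (simp add: pairs_def n_subsets)

lemma pairsE:
  assumes "e \<in> pairs S"
  obtains u v where "e = {u, v}" "u \<in> S" "v \<in> S" "u \<noteq> v"
  using assms by (auto simp: pairs_def card_2_iff)

lemma image_in_pairs: "inj_on h S \<Longrightarrow> e \<in> pairs S \<Longrightarrow> h ` e \<in> pairs (h ` S)"
  by (auto simp: pairs_def card_image inj_on_subset)

lemma pairs_image:
  assumes "inj_on h S"
  shows "pairs (h ` S) = (`) h ` pairs S"
proof (intro equalityI subsetI)
  fix e assume "e \<in> pairs (h ` S)"
  then obtain u v where "e = {h u, h v}" "u \<in> S" "v \<in> S" "h u \<noteq> h v"
    by (elim pairsE) auto
  then show "e \<in> (`) h ` pairs S"
    by (intro image_eqI[of _ _ "{u, v}"]) (auto simp: insert_in_pairs_iff)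
qed (use assms image_in_pairs in blast)

lemma isomorphic_complete_graph_iff:
  assumes "simple_graph F"
  shows "isomorphic F (complete_graph t) \<longleftrightarrow> card (verts F) = t \<and> edges F = pairs (verts F)"
proof
  assume "isomorphic F (complete_graph t)"
  then obtain f where f: "bij_betw f (verts F) {1..t}"
    and e: "\<And>u v. u \<in> verts F \<Longrightarrow> v \<in> verts F \<Longrightarrow> {u, v} \<in> edges F \<longleftrightarrow> {f u, f v} \<in> pairs {1..t}"
    by (auto simp: isomorphic_def complete_graph_def pairs_def)
  have "edges F \<subseteq> pairs (verts F)"
    using assms by (auto simp: simple_graph_def pairs_def)
  moreover have "pairs (verts F) \<subseteq> edges F"
  proof
    fix p assume "p \<in> pairs (verts F)"
    then obtain u v where p: "p = {u, v}" "u \<in> verts F" "v \<in> verts F" "u \<noteq> v"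
      by (elim pairsE)
    then have "f u \<noteq> f v" "f u \<in> {1..t}" "f v \<in> {1..t}"
      using bij_betw_apply[OF f] bij_betw_imp_inj_on[OF f] by (simp_all add: inj_on_eq_iff)
    then show "p \<in> edges F"
      using e p by (simp add: insert_in_pairs_iff)
  qed
  ultimately show "card (verts F) = t \<and> edges F = pairs (verts F)"
    using bij_betw_same_card[OF f] by auto
next
  assume F: "card (verts F) = t \<and> edges F = pairs (verts F)"
  then obtain f where f: "bij_betw f (verts F) {1..t}"
    using assms finite_same_card_bij[of "verts F" "{1..t}"] by (auto simp: simple_graph_def)
  then have "{u, v} \<in> pairs (verts F) \<longleftrightarrow> {f u, f v} \<in> pairs {1..t}"
    if "u \<in> verts F" "v \<in> verts F" for u v
    using that unfolding insert_in_pairs_iff bij_betw_def by (auto simp: inj_on_def)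
  with f F show "isomorphic F (complete_graph t)"
    by (auto simp: isomorphic_def complete_graph_def pairs_def intro!: exI[of _ f])
qed

text \<open>A copy of a complete graph is determined by its vertex set. From here on isomorphisms
  disappear and only \<open>t\<close>-subsets are counted.\<close>

lemma copies_complete_graph:
  "copies (complete_graph t) (complete_graph n) = (\<lambda>S. (S, pairs S)) ` {S. S \<subseteq> {1..n} \<and> card S = t}"
proof (intro equalityI subsetI)
  fix F assume "F \<in> copies (complete_graph t) (complete_graph n)"
  then have "simple_graph F" "verts F \<subseteq> {1..n}" "isomorphic F (complete_graph t)"
    by (auto simp: copies_def subgraph_def complete_graph_def)
  then show "F \<in> (\<lambda>S. (S, pairs S)) ` {S. S \<subseteq> {1..n} \<and> card S = t}"
    by (intro image_eqI[of _ _ "verts F"]) (auto simp: isomorphic_complete_graph_iff prod_eq_iff)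
next
  fix F assume "F \<in> (\<lambda>S. (S, pairs S)) ` {S. S \<subseteq> {1..n} \<and> card S = t}"
  then obtain S where S: "F = (S, pairs S)" "S \<subseteq> {1..n}" "card S = t" by auto
  then have "simple_graph F"
    using finite_subset[of S "{1..n}"] by (auto simp: simple_graph_def pairs_def)
  then show "F \<in> copies (complete_graph t) (complete_graph n)"
    using S pairs_mono[OF S(2)]
    by (auto simp: copies_def subgraph_def isomorphic_complete_graph_iff edges_complete_graph)
      (auto simp: complete_graph_def)
qed

lemma card_copies_complete_graph:
  "card (copies (complete_graph t) (complete_graph n)) = n choose t"
  by (simp add: copies_complete_graph card_image inj_on_def n_subsets)

lemma card_rainbow_copies_complete_graph:
  "card (rainbow_copies c (complete_graph t) (complete_graph n)) = card (rainbow_sets t c {1..n})"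
proof -
  have "rainbow_copies c (complete_graph t) (complete_graph n) =
      (\<lambda>S. (S, pairs S)) ` rainbow_sets t c {1..n}"
    by (auto simp: rainbow_copies_def copies_complete_graph rainbow_def rainbow_sets_def)
  then show ?thesis
    by (simp add: card_image inj_on_def)
qed

lemma finite_rainbow_sets: "finite A \<Longrightarrow> finite (rainbow_sets t c A)"
  by (simp add: rainbow_sets_def)

lemma rainbow_sets_mono: "A \<subseteq> B \<Longrightarrow> rainbow_sets t c A \<subseteq> rainbow_sets t c B"
  by (auto simp: rainbow_sets_def)

lemma card_rainbow_sets_le: "finite A \<Longrightarrow> card (rainbow_sets t c A) \<le> card A choose t"
  by (subst n_subsets[symmetric]) (auto simp: rainbow_sets_def intro!: card_mono)

lemma rainbow_sets_cong:
  assumes "\<And>e. e \<in> pairs A \<Longrightarrow> c e = d e"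
  shows "rainbow_sets t c A = rainbow_sets t d A"
proof -
  have "inj_on c (pairs S) \<longleftrightarrow> inj_on d (pairs S)" if "S \<subseteq> A" for S
    using pairs_mono[OF that] assms by (intro inj_on_cong) auto
  then show ?thesis by (auto simp: rainbow_sets_def)
qed

text \<open>Invariance under relabelling: \<open>h\<close> carries rainbow sets of the pulled-back
  coloring to rainbow sets of \<open>c\<close>. This later transports a coloring of an arbitrary
  finite set to an initial segment.\<close>

lemma card_rainbow_sets_image:
  assumes "inj_on h A"
  shows "card (rainbow_sets t c (h ` A)) = card (rainbow_sets t (\<lambda>e. c (h ` e)) A)"
proof -
  have inj: "inj_on c (pairs (h ` S)) \<longleftrightarrow> inj_on (\<lambda>e. c (h ` e)) (pairs S)" if "S \<subseteq> A" for S
  proof -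
    have "inj_on h S" using assms that inj_on_subset by blast
    moreover have "inj_on ((`) h) (pairs S)"
      by (rule inj_on_subset[OF inj_on_image_Pow[OF \<open>inj_on h S\<close>]]) (auto simp: pairs_def)
    ultimately show ?thesis
      by (simp add: pairs_image comp_inj_on_iff o_def)
  qed
  have "rainbow_sets t c (h ` A) = (`) h ` rainbow_sets t (\<lambda>e. c (h ` e)) A"
  proof (intro equalityI subsetI)
    fix S assume S: "S \<in> rainbow_sets t c (h ` A)"
    then obtain S' where "S' \<subseteq> A" "S = h ` S'"
      by (auto simp: rainbow_sets_def subset_image_iff)
    with S show "S \<in> (`) h ` rainbow_sets t (\<lambda>e. c (h ` e)) A"
      using inj[of S'] inj_on_subset[OF assms]
      by (auto simp: rainbow_sets_def card_image)
  next
    fix S assume "S \<in> (`) h ` rainbow_sets t (\<lambda>e. c (h ` e)) A"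
    then show "S \<in> rainbow_sets t c (h ` A)"
      using inj inj_on_subset[OF assms] by (auto simp: rainbow_sets_def card_image)
  qed
  moreover have "inj_on ((`) h) (rainbow_sets t (\<lambda>e. c (h ` e)) A)"
    by (rule inj_on_subset[OF inj_on_image_Pow[OF assms]]) (auto simp: rainbow_sets_def)
  ultimately show ?thesis
    by (simp add: card_image)
qed

section \<open>Lower bound from the coloring by sums modulo \<open>r\<close>\<close>

text \<open>The admissible \<open>w\<close> lie in a single residue class modulo \<open>r\<close>,
  so \<open>w\<close> is determined by \<open>w div r\<close>, which is at most
  \<open>n div r\<close>.\<close>

lemma card_residue_class_le:
  fixes n r u v :: nat
  shows "card {w \<in> {1..n}. (u + w) mod r = v mod r} \<le> n div r + 1"
proof -
  let ?W = "{w \<in> {1..n}. (u + w) mod r = v mod r}"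
  have "inj_on (\<lambda>w. w div r) ?W"
  proof (rule inj_onI)
    fix w w' assume w: "w \<in> ?W" "w' \<in> ?W" and d: "w div r = w' div r"
    \<comment> \<open>Over the integers, congruence means divisibility of the difference, in which
      \<open>u\<close> cancels.\<close>
    then have "(int u + int w) mod int r = (int u + int w') mod int r"
      by (metis (mono_tags, lifting) mem_Collect_eq of_nat_add of_nat_mod)
    then have "int w mod int r = int w' mod int r"
      by (simp add: mod_eq_dvd_iff)
    then have "w mod r = w' mod r"
      by (metis nat_int of_nat_mod)
    with d show "w = w'" by (metis div_mult_mod_eq)
  qed
  then have "card ?W \<le> card {..n div r}"
    by (rule card_inj_on_le) (auto simp: div_le_mono)
  then show ?thesis by simp
qed

text \<open>Distinct edges of equal size leave some \<open>l\<close> in \<open>a\<close> but not in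
  \<open>b\<close>. Once \<open>f\<close> is chosen on the other \<open>t - 1\<close> indices, a
  collision prescribes the residue of \<open>f l\<close>.\<close>

lemma card_sum_collision_le:
  fixes n r t :: nat
  assumes q: "a \<in> pairs {..<t}" "b \<in> pairs {..<t}" "a \<noteq> b"
  shows "card {f \<in> {..<t} \<rightarrow>\<^sub>E {1..n}. (\<Sum>i\<in>a. f i) mod r = (\<Sum>i\<in>b. f i) mod r}
           \<le> n ^ (t - 1) * (n div r + 1)" (is "card ?B \<le> _")
proof -
  have "finite a" "finite b" "card a = card b"
    using q by (auto simp: pairs_def intro: card_ge_0_finite)
  then have "\<not> a \<subseteq> b" using q(3) by (metis card_subset_eq)
  then obtain l where l: "l \<in> a" "l \<notin> b" by blast
  have lt: "l < t" "a \<subseteq> {..<t}" "b \<subseteq> {..<t}" using l q by (auto simp: pairs_def)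
  let ?I = "{..<t} - {l}"
  let ?W = "\<lambda>g. {w \<in> {1..n}. ((\<Sum>i\<in>a - {l}. g i) + w) mod r = (\<Sum>i\<in>b. g i) mod r}"
  \<comment> \<open>Splits \<open>f\<close> into its part off \<open>l\<close> and its value at
    \<open>l\<close>. The target is fibered over the first part, with the residue class
    \<open>?W g\<close> as fiber.\<close>
  let ?\<phi> = "\<lambda>f. (restrict f ?I, f l)"
  have "inj_on ?\<phi> ?B"
  proof (rule inj_onI)
    fix f g assume fg: "f \<in> ?B" "g \<in> ?B" "?\<phi> f = ?\<phi> g"
    have "f i = g i" if "i \<in> {..<t}" for i
      using fg(3) that by (cases "i = l") (auto dest: fun_cong[of _ _ i])
    with fg(1,2) show "f = g" by (intro PiE_ext[of f "{..<t}" _ g]) auto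
  qed
  moreover have "?\<phi> ` ?B \<subseteq> Sigma (?I \<rightarrow>\<^sub>E {1..n}) ?W"
  proof
    fix p assume "p \<in> ?\<phi> ` ?B"
    then obtain f where f: "f \<in> ?B" "p = ?\<phi> f" by blast
    have "(\<Sum>i\<in>a - {l}. restrict f ?I i) + f l = (\<Sum>i\<in>a. f i)"
      using l lt \<open>finite a\<close> by (subst sum.remove[of a l]) (auto intro!: sum.cong)
    moreover have "(\<Sum>i\<in>b. restrict f ?I i) = (\<Sum>i\<in>b. f i)"
      using l lt by (intro sum.cong) auto
    ultimately show "p \<in> Sigma (?I \<rightarrow>\<^sub>E {1..n}) ?W"
      using f lt by (auto simp: PiE_iff)
  qed
  moreover have fin: "finite (?I \<rightarrow>\<^sub>E {1..n})" by (simp add: finite_PiE)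
  ultimately have "card ?B \<le> card (Sigma (?I \<rightarrow>\<^sub>E {1..n}) ?W)"
    by (intro card_inj_on_le) auto
  also have "\<dots> = (\<Sum>g\<in>?I \<rightarrow>\<^sub>E {1..n}. card (?W g))"
    using fin by simp
  also have "\<dots> \<le> (\<Sum>g\<in>?I \<rightarrow>\<^sub>E {1..n}. n div r + 1)"
    by (intro sum_mono card_residue_class_le)
  also have "\<dots> = n ^ (t - 1) * (n div r + 1)"
    using lt by (simp add: card_funcsetE)
  finally show ?thesis .
qed

text \<open>If \<open>f i = f j\<close>, a third index \<open>k\<close> makes the edges
  \<open>ik\<close> and \<open>jk\<close> collide, so noninjective choices need no count of their
  own. The sums run over indices so that they make sense before injectivity is known; afterwards
  they agree with the sums over the image edges.\<close>

lemma collision_free_rainbow: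
  fixes n r t :: nat
  assumes "t \<ge> 3" and f: "f \<in> {..<t} \<rightarrow>\<^sub>E {1..n}"
    and inj: "inj_on (\<lambda>a. (\<Sum>i\<in>a. f i) mod r) (pairs {..<t})"
  shows "inj_on f {..<t}" "f ` {..<t} \<in> rainbow_sets t (\<lambda>e. Suc (\<Sum>e mod r)) {1..n}"
proof -
  show inj_f: "inj_on f {..<t}"
  proof (rule inj_onI, rule ccontr)
    fix i j assume ij: "i \<in> {..<t}" "j \<in> {..<t}" "f i = f j" "i \<noteq> j"
    have "\<not> {..<t} \<subseteq> {i, j}"
      using \<open>t \<ge> 3\<close> card_mono[of "{i, j}" "{..<t}"] ij(4) by auto
    then obtain k where k: "k < t" "k \<noteq> i" "k \<noteq> j" by auto
    then have "{i, k} \<in> pairs {..<t}" "{j, k} \<in> pairs {..<t}"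
      using ij by (auto simp: insert_in_pairs_iff)
    moreover have "(\<Sum>i\<in>{i, k}. f i) mod r = (\<Sum>i\<in>{j, k}. f i) mod r"
      using k ij by simp
    ultimately have "{i, k} = {j, k}" using inj by (auto dest: inj_onD)
    then show False using k ij by (auto simp: doubleton_eq_iff)
  qed
  have "inj_on (\<lambda>e. Suc (\<Sum>e mod r)) ((`) f ` pairs {..<t})"
  proof (rule inj_onI)
    fix d e assume de: "d \<in> (`) f ` pairs {..<t}" "e \<in> (`) f ` pairs {..<t}"
      "Suc (\<Sum>d mod r) = Suc (\<Sum>e mod r)"
    then obtain a b where ab: "a \<in> pairs {..<t}" "b \<in> pairs {..<t}" "d = f ` a" "e = f ` b"
      by auto
    then have "inj_on f a" "inj_on f b"
      using inj_on_subset[OF inj_f] by (auto simp: pairs_def)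
    then have "\<Sum>d = (\<Sum>i\<in>a. f i)" "\<Sum>e = (\<Sum>i\<in>b. f i)"
      using ab by (auto simp: sum.reindex)
    with de(3) have "a = b" using inj ab by (auto dest: inj_onD)
    then show "d = e" using ab by simp
  qed
  then show "f ` {..<t} \<in> rainbow_sets t (\<lambda>e. Suc (\<Sum>e mod r)) {1..n}"
    using f inj_f by (auto simp: rainbow_sets_def card_image pairs_image)
qed

text \<open>Passes from functions to sets: a rainbow set arises from at most \<open>fact t\<close>
  choices of \<open>f\<close>.\<close>

lemma card_inj_funcset_with_image_le:
  assumes "card S = t" "finite S"
  shows "card {f \<in> {..<t} \<rightarrow>\<^sub>E A. inj_on f {..<t} \<and> f ` {..<t} = S} \<le> fact t"
proof -
  have "finite {f \<in> {..<t} \<rightarrow>\<^sub>E S. inj_on f {..<t}}"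
    using assms by (simp add: finite_PiE)
  then have "card {f \<in> {..<t} \<rightarrow>\<^sub>E A. inj_on f {..<t} \<and> f ` {..<t} = S}
      \<le> card {f \<in> {..<t} \<rightarrow>\<^sub>E S. inj_on f {..<t}}"
    by (rule card_mono) auto
  also have "\<dots> = prod ((-) t) {0..<t}"
    using assms by (simp add: card_inj_on_subset_funcset)
  also have "\<dots> = fact t"
    by (simp add: fact_prod_rev)
  finally show ?thesis .
qed

text \<open>For \<open>t \<ge> 4\<close> the collisions of the edges \<open>02, 12\<close> and of the edges \<open>03, 13\<close> are the same event
  \<open>f 0 \<equiv> f 1\<close>, so one of the pairs of edges of \<open>K\<^sub>t\<close> need not be counted.\<close>
lemma card_rainbow_sets_sum_coloring_ge:
  fixes n r t :: nat
  assumes t: "t \<ge> 4"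
  shows "n ^ t \<le> fact t * card (rainbow_sets t (\<lambda>e. Suc (\<Sum>e mod r)) {1..n})
           + (((t choose 2) choose 2) - 1) * (n ^ (t - 1) * (n div r + 1))"
proof -
  let ?X = "{..<t} \<rightarrow>\<^sub>E {1..n}"
  let ?s = "\<lambda>f a. (\<Sum>i\<in>a. f i) mod r"
  let ?R = "rainbow_sets t (\<lambda>e. Suc (\<Sum>e mod r)) {1..n}"
  let ?Q = "pairs (pairs {..<t})"
  let ?q = "\<lambda>k. {{0, k}, {1, k}} :: nat set set"
  define G where "G = {f \<in> ?X. inj_on (?s f) (pairs {..<t})}"
  \<comment> \<open>\<open>G\<close> consists of the collision-free choices, and \<open>B q\<close>
    is the event that the two edges in \<open>q\<close> collide. Noninjectivity expresses this
    without ordering the pair.\<close>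
  define B where "B = (\<lambda>q. {f \<in> ?X. \<not> inj_on (?s f) q})"
  have finX: "finite ?X" by (simp add: finite_PiE)
  have finQ: "finite ?Q" by (simp add: finite_pairs)
  have qQ: "?q k \<in> ?Q" if "2 \<le> k" "k < t" for k
    using that t by (auto simp: insert_in_pairs_iff doubleton_eq_iff)
  have Bq: "B (?q k) = {f \<in> ?X. f 0 mod r = f 1 mod r}" if "2 \<le> k" for k
  proof -
    have "{0, k} \<noteq> {1, k}" using that by (auto simp: doubleton_eq_iff)
    moreover have "(f 0 + f k) mod r = (f 1 + f k) mod r \<longleftrightarrow> f 0 mod r = f 1 mod r"
      for f :: "nat \<Rightarrow> nat"
      using cong_add_rcancel_nat[of "f 0" "f k" "f 1" r] by (simp add: cong_def)
    ultimately show ?thesis using that by (auto simp: B_def)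
  qed
  have "?q 3 \<noteq> ?q 2" by (auto simp: doubleton_eq_iff)
  have "?X \<subseteq> G \<union> (\<Union>q\<in>?Q - {?q 3}. B q)"
  proof
    fix f assume f: "f \<in> ?X"
    show "f \<in> G \<union> (\<Union>q\<in>?Q - {?q 3}. B q)"
    proof (cases "f \<in> G")
      case False
      then obtain a b where ab: "a \<in> pairs {..<t}" "b \<in> pairs {..<t}" "a \<noteq> b" "?s f a = ?s f b"
        using f by (auto simp: G_def inj_on_def)
      then have q: "{a, b} \<in> ?Q" "f \<in> B {a, b}"
        using f by (auto simp: insert_in_pairs_iff B_def)
      show ?thesis
      proof (cases "{a, b} = ?q 3")
        case True
        then have "f \<in> B (?q 2)" using q Bq[of 3] Bq[of 2] by simp
        moreover have "?q 2 \<in> ?Q - {?q 3}" using qQ[of 2] t \<open>?q 3 \<noteq> ?q 2\<close> by auto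
        ultimately show ?thesis by (intro UnI2 UN_I[of "?q 2"])
      next
        case False
        with q show ?thesis by (intro UnI2 UN_I[of "{a, b}"]) simp_all
      qed
    qed simp
  qed
  then have "card ?X \<le> card (G \<union> (\<Union>q\<in>?Q - {?q 3}. B q))"
    using finX finQ by (intro card_mono) (auto simp: G_def B_def)
  also have "\<dots> \<le> card G + card (\<Union>q\<in>?Q - {?q 3}. B q)"
    by (rule card_Un_le)
  also have "card (\<Union>q\<in>?Q - {?q 3}. B q) \<le> (\<Sum>q\<in>?Q - {?q 3}. card (B q))"
    using finQ by (intro card_UN_le) simp
  also have "\<dots> \<le> (\<Sum>q\<in>?Q - {?q 3}. n ^ (t - 1) * (n div r + 1))"
  proof (rule sum_mono)
    fix q assume "q \<in> ?Q - {?q 3}"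
    then obtain a b where ab: "q = {a, b}" "a \<in> pairs {..<t}" "b \<in> pairs {..<t}" "a \<noteq> b"
      by (metis DiffD1 pairsE)
    then have "B q = {f \<in> ?X. ?s f a = ?s f b}" by (auto simp: B_def)
    then show "card (B q) \<le> n ^ (t - 1) * (n div r + 1)"
      using card_sum_collision_le[OF ab(2-4), of n r] by simp
  qed
  \<comment> \<open>Since \<open>3 < t\<close>, the omitted pair \<open>?q 3\<close> really belongs
    to \<open>?Q\<close>, so its removal lowers the number of terms by one.\<close>
  also have "\<dots> = (((t choose 2) choose 2) - 1) * (n ^ (t - 1) * (n div r + 1))"
    using qQ[of 3] t by (simp add: card_pairs finite_pairs)
  \<comment> \<open>Group the functions in \<open>G\<close> by their images, which are rainbow
    sets.\<close>
  also have "card G \<le> card ?R * fact t"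
  proof -
    have "G \<subseteq> (\<Union>S\<in>?R. {f \<in> ?X. inj_on f {..<t} \<and> f ` {..<t} = S})"
      using collision_free_rainbow[of t _ n r] t by (auto simp: G_def)
    then have "card G \<le> card (\<Union>S\<in>?R. {f \<in> ?X. inj_on f {..<t} \<and> f ` {..<t} = S})"
      using finX by (intro card_mono) (auto simp: finite_rainbow_sets)
    also have "\<dots> \<le> (\<Sum>S\<in>?R. card {f \<in> ?X. inj_on f {..<t} \<and> f ` {..<t} = S})"
      by (intro card_UN_le finite_rainbow_sets) simp
    also have "\<dots> \<le> (\<Sum>S\<in>?R. fact t)"
      by (intro sum_mono card_inj_funcset_with_image_le)
        (auto simp: rainbow_sets_def intro: finite_subset)
    finally show ?thesis by simp
  qed
  finally show ?thesis by (simp add: card_funcsetE algebra_simps)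
qed

lemma coloring_sum_mod:
  fixes n r :: nat
  assumes "r \<ge> 1" "n \<ge> 2 * r"
  shows "coloring r (edges (complete_graph n)) (\<lambda>e. Suc (\<Sum>e mod r))"
  unfolding coloring_def edges_complete_graph
proof (intro equalityI subsetI)
  fix v assume "v \<in> (\<lambda>e. Suc (\<Sum>e mod r)) ` pairs {1..n}"
  then show "v \<in> {1..r}" using assms mod_less_divisor[of r] by (auto simp: Suc_le_eq)
next
  fix v assume v: "v \<in> {1..r}"
  \<comment> \<open>The sum is \<open>v - 1\<close> modulo \<open>r\<close>. The shift by
    \<open>r\<close> avoids the non-vertex 0, and the second vertex stays below \<open>2 * r\<close>
    because \<open>v - 1 < r\<close>.\<close>
  let ?e = "{2 * r, r + (v - 1)}"
  have ne: "2 * r \<noteq> r + (v - 1)" using v by auto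
  have "?e \<in> pairs {1..n}"
    using v assms ne by (auto simp: insert_in_pairs_iff)
  moreover have "\<Sum>?e = (v - 1) + r * 3" using ne by simp
  then have "Suc (\<Sum>?e mod r) = v" using v by (simp only: mod_mult_self2) auto
  ultimately show "v \<in> (\<lambda>e. Suc (\<Sum>e mod r)) ` pairs {1..n}"
    by (metis (no_types, lifting) image_eqI)
qed

lemma card_rainbow_sets_le_max_rainbow:
  assumes "coloring r (edges (complete_graph n)) c"
  shows "card (rainbow_sets t c {1..n}) \<le> max_rainbow (complete_graph t) n r"
proof -
  have "card (rainbow_copies c (complete_graph t) (complete_graph n))
      \<le> max_rainbow (complete_graph t) n r"
    unfolding max_rainbow_def using assms by (intro Max_ge[OF finite_rainbow_counts]) auto
  then show ?thesis by (simp add: card_rainbow_copies_complete_graph)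
qed

text \<open>The given coloring \<open>c'\<close> guarantees that the maximum is over a nonempty
  set.\<close>

lemma max_rainbow_attained:
  assumes "coloring r (edges (complete_graph n)) c'"
  obtains c where "coloring r (edges (complete_graph n)) c"
    "max_rainbow (complete_graph t) n r = card (rainbow_sets t c {1..n})"
proof -
  have "max_rainbow (complete_graph t) n r \<in>
      {card (rainbow_copies c (complete_graph t) (complete_graph n)) | c.
         coloring r (edges (complete_graph n)) c}"
    unfolding max_rainbow_def by (rule Max_in[OF finite_rainbow_counts]) (use assms in blast)
  then show ?thesis
    using that by (auto simp: card_rainbow_copies_complete_graph)
qed

lemma max_rainbow_density_ge:
  fixes n r t :: nat
  assumes t: "t \<ge> 4" and r: "r \<ge> 1" and n: "n \<ge> 2 * r" "n \<ge> t"
  shows "max_rainbow_density (complete_graph t) n r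
           \<ge> 1 - (real ((t choose 2) choose 2) - 1) * (1 / real r + 1 / real n)"
proof -
  define s where "s = (t choose 2) choose 2"
  let ?M = "max_rainbow (complete_graph t) n r"
  \<comment> \<open>This leads to \<open>s \<ge> 1\<close>, so that the truncated
    \<open>s - 1\<close> of the counting bound agrees with the real difference.\<close>
  have "4 * 3 \<le> t * (t - 1)" using t by (intro mult_le_mono) auto
  then have "2 \<le> t choose 2" by (simp add: choose_two)
  then have s: "s \<ge> 1" by (simp add: s_def Suc_le_eq)
  have n0: "n > 0" using n t by simp
  have "n ^ t \<le> fact t * ?M + (s - 1) * (n ^ (t - 1) * (n div r + 1))"
    using card_rainbow_sets_sum_coloring_ge[OF t, of n r]
      card_rainbow_sets_le_max_rainbow[OF coloring_sum_mod[OF r n(1)], of t]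
    unfolding s_def by (meson add_le_mono1 le_trans mult_le_mono2)
  then have "real (n ^ t) \<le> real (fact t * ?M + (s - 1) * (n ^ (t - 1) * (n div r + 1)))"
    by (rule of_nat_mono)
  also have "\<dots> = fact t * ?M + (real s - 1) * (real n ^ (t - 1) * (real (n div r) + 1))"
    using s by (simp add: of_nat_diff distrib_left)
  also have "\<dots> \<le> fact t * ?M + (real s - 1) * (real n ^ (t - 1) * (real n / real r + 1))"
    using s of_nat_div_le_of_nat[of n r, where 'a = real] by (intro add_left_mono mult_left_mono) auto
  also have "real n ^ (t - 1) * (real n / real r + 1) = real n ^ t * (1 / real r + 1 / real n)"
    using n0 t power_minus_mult[of t "real n"] by (auto simp: field_simps)
  finally have "real n ^ t * (1 - (real s - 1) * (1 / real r + 1 / real n)) \<le> fact t * ?M"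
    by (simp add: algebra_simps)
  then have "1 - (real s - 1) * (1 / real r + 1 / real n) \<le> fact t * ?M / real n ^ t"
    using n0 by (simp add: field_simps)
  \<comment> \<open>The number \<open>fact t * (n choose t)\<close> of injective choices is at most
    \<open>n ^ t\<close>, so the smaller denominator can only raise the quotient.\<close>
  also have "\<dots> \<le> fact t * ?M / (fact t * real (n choose t))"
  proof (rule divide_left_mono)
    have "real ((n choose t) * fact t) \<le> real (n ^ t)"
      by (rule of_nat_mono[OF binomial_fact_pow])
    then show "fact t * real (n choose t) \<le> real n ^ t" by (simp add: mult.commute)
  qed (use n n0 in auto)
  finally show ?thesis
    by (simp add: max_rainbow_density_def card_copies_complete_graph s_def)
qed

section \<open>Existence of the limit density\<close>

text \<open>The maximum over colorings with at most \<open>r\<close> colors. Unlike surjectivity,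
  this condition survives the deletion of vertices.\<close>

definition max_rainbow_le :: "nat \<Rightarrow> nat \<Rightarrow> nat \<Rightarrow> nat" where
  "max_rainbow_le t n r = Max {card (rainbow_sets t c {1..n}) | c. c \<in> pairs {1..n} \<rightarrow> {1..r}}"

lemma finite_max_rainbow_le:
  "finite {card (rainbow_sets t c {1..n}) | c. c \<in> pairs {1..n::nat} \<rightarrow> {1..r::nat}}"
  by (rule finite_subset[of _ "{..n choose t}"]) (use card_rainbow_sets_le[of "{1..n}" t] in auto)

lemma max_rainbow_le_attained:
  assumes "r \<ge> 1"
  obtains c where "c \<in> pairs {1..n} \<rightarrow> {1..r}"
    "max_rainbow_le t n r = card (rainbow_sets t c {1..n})"
proof -
  have "(\<lambda>_. 1) \<in> pairs {1..n} \<rightarrow> {1..r}" using assms by auto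
  then have "max_rainbow_le t n r \<in> {card (rainbow_sets t c {1..n}) | c. c \<in> pairs {1..n} \<rightarrow> {1..r}}"
    unfolding max_rainbow_le_def by (intro Max_in finite_max_rainbow_le) blast
  then show ?thesis using that by blast
qed

text \<open>Relabel \<open>A\<close> as an initial segment. This is needed because deleting a vertex
  leaves an arbitrary set.\<close>

lemma card_rainbow_sets_le_max:
  fixes A :: "nat set"
  assumes "finite A" "c \<in> pairs A \<rightarrow> {1..r}"
  shows "card (rainbow_sets t c A) \<le> max_rainbow_le t (card A) r"
proof -
  obtain h where h: "bij_betw h {1..card A} A"
    using assms(1) finite_same_card_bij[of "{1..card A}" A] by auto
  then have h': "inj_on h {1..card A}" "h ` {1..card A} = A"
    by (auto simp: bij_betw_def)
  let ?c = "\<lambda>e. c (h ` e)"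
  have "?c \<in> pairs {1..card A} \<rightarrow> {1..r}"
    using assms(2) image_in_pairs[OF h'(1)] h'(2) by fastforce
  then have "card (rainbow_sets t ?c {1..card A}) \<le> max_rainbow_le t (card A) r"
    unfolding max_rainbow_le_def by (intro Max_ge finite_max_rainbow_le) blast
  then show ?thesis
    using card_rainbow_sets_image[OF h'(1), of t c] h'(2) by simp
qed

text \<open>Double counting: a rainbow set survives the deletion of \<open>v\<close> exactly when it
  avoids \<open>v\<close>, and it avoids \<open>card A - t\<close> vertices.\<close>

lemma sum_card_rainbow_sets_delete:
  assumes "finite A" "t \<le> card A"
  shows "(\<Sum>v\<in>A. card (rainbow_sets t c (A - {v}))) = (card A - t) * card (rainbow_sets t c A)"
proof -
  have "rainbow_sets t c (A - {v}) = {S \<in> rainbow_sets t c A. v \<notin> S}" for v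
    by (auto simp: rainbow_sets_def)
  moreover have "card {v \<in> A. v \<notin> S} = card A - t" if "S \<in> rainbow_sets t c A" for S
  proof -
    have "{v \<in> A. v \<notin> S} = A - S" by auto
    then show ?thesis
      using that assms finite_subset[of S A] by (auto simp: rainbow_sets_def card_Diff_subset)
  qed
  ultimately show ?thesis
    using assms by (simp add: sum_multicount[where k = "card A - t"] finite_rainbow_sets)
qed

text \<open>Take an optimal coloring on \<open>Suc n\<close> vertices and sum over all ways to
  delete one vertex.\<close>

lemma max_rainbow_le_Suc:
  assumes "r \<ge> 1" "t \<le> n"
  shows "(Suc n - t) * max_rainbow_le t (Suc n) r \<le> Suc n * max_rainbow_le t n r"
proof -
  let ?A = "{1..Suc n}"
  obtain c where c: "c \<in> pairs ?A \<rightarrow> {1..r}"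
    "max_rainbow_le t (Suc n) r = card (rainbow_sets t c ?A)"
    using max_rainbow_le_attained[OF assms(1)] by metis
  have "(Suc n - t) * max_rainbow_le t (Suc n) r = (\<Sum>v\<in>?A. card (rainbow_sets t c (?A - {v})))"
    using sum_card_rainbow_sets_delete[of ?A t c] c assms by simp
  also have "\<dots> \<le> (\<Sum>v\<in>?A. max_rainbow_le t n r)"
  proof (rule sum_mono)
    fix v assume "v \<in> ?A"
    moreover have "c \<in> pairs (?A - {v}) \<rightarrow> {1..r}"
      using c(1) pairs_mono[of "?A - {v}" ?A] by blast
    ultimately show "card (rainbow_sets t c (?A - {v})) \<le> max_rainbow_le t n r"
      using card_rainbow_sets_le_max[of "?A - {v}" c r t] by simp
  qed
  finally show ?thesis by simp
qed

lemma max_rainbow_le_density_convergent: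
  assumes "r \<ge> 1"
  obtains L where "(\<lambda>n. real (max_rainbow_le t n r) / real (n choose t)) \<longlonglongrightarrow> L"
proof -
  let ?d = "\<lambda>n. real (max_rainbow_le t n r) / real (n choose t)"
  have step: "?d (Suc n) \<le> ?d n" if "t \<le> n" for n
  proof -
    have pos: "real (n choose t) > 0" "real (Suc n choose t) > 0" using that by simp_all
    \<comment> \<open>The binomial coefficients satisfy the recursion of
      \<open>max_rainbow_le_Suc\<close> with equality, so the quotients decrease.\<close>
    have "real ((Suc n - t) * (Suc n choose t)) = real (Suc n * (n choose t))"
      using binomial_absorb_comp[of "Suc n" t] by simp
    then have eq: "real (Suc n - t) * real (Suc n choose t) = real (Suc n) * real (n choose t)"
      by (simp only: of_nat_mult)
    have le: "real (Suc n - t) * real (max_rainbow_le t (Suc n) r) \<le> real (Suc n) * real (max_rainbow_le t n r)"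
      using max_rainbow_le_Suc[OF assms that] by (metis of_nat_le_iff of_nat_mult)
    have nz: "real (Suc n - t) > 0" using that by simp
    have "?d (Suc n) = (real (Suc n - t) * real (max_rainbow_le t (Suc n) r)) / (real (Suc n - t) * real (Suc n choose t))"
      using nz by simp
    also have "\<dots> \<le> (real (Suc n) * real (max_rainbow_le t n r)) / (real (Suc n) * real (n choose t))"
      unfolding eq by (intro divide_right_mono le) simp
    finally show ?thesis by simp
  qed
  \<comment> \<open>Below \<open>t\<close> the quotient is 0 by division by zero, so monotonicity is
    claimed only from \<open>t\<close> on.\<close>
  have "decseq (\<lambda>n. ?d (n + t))"
    by (rule decseq_SucI) (use step in simp)
  then obtain L where "(\<lambda>n. ?d (n + t)) \<longlonglongrightarrow> L"
    by (rule decseq_convergent[of _ 0]) auto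
  then have "?d \<longlonglongrightarrow> L" by (rule LIMSEQ_offset)
  then show ?thesis by (rule that)
qed

lemma max_rainbow_le_max_rainbow_le:
  assumes "coloring r (edges (complete_graph n)) c"
  shows "max_rainbow (complete_graph t) n r \<le> max_rainbow_le t n r"
proof -
  obtain d where d: "coloring r (edges (complete_graph n)) d"
    "max_rainbow (complete_graph t) n r = card (rainbow_sets t d {1..n})"
    using max_rainbow_attained[OF assms] by metis
  then have "d \<in> pairs {1..n} \<rightarrow> {1..r}"
    by (auto simp: coloring_def edges_complete_graph)
  then show ?thesis
    using card_rainbow_sets_le_max[of "{1..n}" d r t] d by simp
qed

lemma max_rainbow_le_le_max_rainbow:
  assumes "r \<ge> 1"
  shows "max_rainbow_le t m r \<le> max_rainbow (complete_graph t) (m + Suc r) r"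
proof -
  let ?n = "m + Suc r"
  obtain c where c: "c \<in> pairs {1..m} \<rightarrow> {1..r}"
    "max_rainbow_le t m r = card (rainbow_sets t c {1..m})"
    using max_rainbow_le_attained[OF assms] by metis
  \<comment> \<open>Old edges keep their colors. Any other edge is colored by the distance of its
    smaller endpoint from the last vertex, clamped to \<open>{1..r}\<close>.\<close>
  define d where "d e = (if e \<in> pairs {1..m} then c e else max 1 (min r (?n - Min e)))" for e
  have "d ` pairs {1..?n} = {1..r}"
  proof (intro equalityI subsetI)
    fix i assume "i \<in> d ` pairs {1..?n}"
    then show "i \<in> {1..r}" using c(1) assms by (auto simp: d_def)
  next
    fix i assume i: "i \<in> {1..r}"
    \<comment> \<open>The \<open>Suc r\<close> new vertices include \<open>?n\<close> and every
      \<open>?n - i\<close> with \<open>i \<le> r\<close>; the distance is \<open>i\<close>, so each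
      color occurs.\<close>
    let ?e = "{?n, ?n - i}"
    have "?e \<in> pairs {1..?n}" "?e \<notin> pairs {1..m}"
      using i by (auto simp: insert_in_pairs_iff)
    moreover from this have "d ?e = i" using i by (auto simp: d_def)
    ultimately show "i \<in> d ` pairs {1..?n}" by (metis image_eqI)
  qed
  then have "coloring r (edges (complete_graph ?n)) d"
    by (simp add: coloring_def edges_complete_graph)
  then have "card (rainbow_sets t d {1..?n}) \<le> max_rainbow (complete_graph t) ?n r"
    by (rule card_rainbow_sets_le_max_rainbow)
  moreover have "rainbow_sets t c {1..m} = rainbow_sets t d {1..m}"
    by (rule rainbow_sets_cong) (simp add: d_def)
  moreover have "card (rainbow_sets t d {1..m}) \<le> card (rainbow_sets t d {1..?n})"
    by (intro card_mono finite_rainbow_sets rainbow_sets_mono) auto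
  ultimately show ?thesis using c(2) by simp
qed

text \<open>Iterated Pascal rule: each of the \<open>k\<close> increments is at most the last one.
  For \<open>k = 0\<close> the truncated subtraction is harmless, as its term is multiplied by
  0.\<close>

lemma binomial_add_le: "(m + k) choose Suc u \<le> (m choose Suc u) + k * ((m + k - 1) choose u)"
proof (induction k)
  case (Suc k)
  have "(m + k - 1) choose u \<le> (m + k) choose u"
    by (rule binomial_right_mono) simp
  then have "k * ((m + k - 1) choose u) \<le> k * ((m + k) choose u)" by (rule mult_le_mono2)
  moreover have "(m + Suc k) choose Suc u = ((m + k) choose u) + ((m + k) choose Suc u)"
    "Suc k * ((m + Suc k - 1) choose u) = ((m + k) choose u) + k * ((m + k) choose u)"
    by simp_all
  ultimately show ?case using Suc by linarith
qed simp

text \<open>A union bound: each of the \<open>k\<close> extra vertices lies in a fraction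
  \<open>t / (m + k)\<close> of all \<open>t\<close>-sets.\<close>

lemma binomial_ratio_ge:
  assumes "t \<ge> 1" "m \<ge> t"
  shows "1 - real k * real t / real (m + k) \<le> real (m choose t) / real ((m + k) choose t)"
proof -
  obtain u where u: "t = Suc u" using assms(1) by (cases t) auto
  have "real t * real ((m + k) choose t) = real (m + k) * real ((m + k - 1) choose u)"
    using times_binomial_minus1_eq[of t "m + k"] assms unfolding u
    by (metis diff_Suc_1 of_nat_mult zero_less_Suc)
  then have "real ((m + k - 1) choose u) = real t / real (m + k) * real ((m + k) choose t)"
    using assms by (simp add: field_simps)
  moreover have "real ((m + k) choose t) \<le> real (m choose t) + real k * real ((m + k - 1) choose u)"
    using binomial_add_le[of m k u] unfolding u by (metis of_nat_add of_nat_le_iff of_nat_mult)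
  ultimately have "real ((m + k) choose t) * (1 - real k * real t / real (m + k)) \<le> real (m choose t)"
    by (simp add: algebra_simps)
  moreover have "real ((m + k) choose t) > 0" using assms by simp
  ultimately show ?thesis by (simp add: field_simps)
qed

lemma max_rainbow_density_convergent:
  assumes "r \<ge> 1" "t \<ge> 1"
  shows "convergent (\<lambda>n. max_rainbow_density (complete_graph t) n r)"
proof -
  let ?d = "\<lambda>n. max_rainbow_density (complete_graph t) n r"
  let ?d' = "\<lambda>n. real (max_rainbow_le t n r) / real (n choose t)"
  let ?k = "Suc r"
  obtain L where L: "?d' \<longlonglongrightarrow> L"
    using max_rainbow_le_density_convergent[OF assms(1)] by metis
  \<comment> \<open>Squeeze: extending an optimal coloring of \<open>m\<close> vertices costs only a
    factor tending to 1, while every surjective coloring competes in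
    \<open>max_rainbow_le\<close>.\<close>
  have "(\<lambda>m. ?d (m + ?k)) \<longlonglongrightarrow> L"
  proof (rule tendsto_sandwich)
    have "(\<lambda>m. real ?k * real t / real (m + ?k)) \<longlonglongrightarrow> 0"
      by (rule LIMSEQ_ignore_initial_segment[OF lim_const_over_n])
    from tendsto_mult[OF L tendsto_diff[OF tendsto_const[of 1] this]]
    show "(\<lambda>m. ?d' m * (1 - real ?k * real t / real (m + ?k))) \<longlonglongrightarrow> L" by simp
    show "(\<lambda>m. ?d' (m + ?k)) \<longlonglongrightarrow> L"
      by (rule LIMSEQ_ignore_initial_segment[OF L])
    show "\<forall>\<^sub>F m in sequentially. ?d' m * (1 - real ?k * real t / real (m + ?k)) \<le> ?d (m + ?k)"
      using eventually_ge_at_top[of t]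
    proof eventually_elim
      case (elim m)
      have "?d' m * (1 - real ?k * real t / real (m + ?k))
          \<le> ?d' m * (real (m choose t) / real ((m + ?k) choose t))"
        by (intro mult_left_mono binomial_ratio_ge assms elim) simp
      also have "\<dots> = real (max_rainbow_le t m r) / real ((m + ?k) choose t)"
        using elim by simp
      also have "\<dots> \<le> ?d (m + ?k)"
        unfolding max_rainbow_density_def card_copies_complete_graph
        using max_rainbow_le_le_max_rainbow[OF assms(1), of t m]
        by (intro divide_right_mono) simp_all
      finally show ?case .
    qed
    show "\<forall>\<^sub>F m in sequentially. ?d (m + ?k) \<le> ?d' (m + ?k)"
      \<comment> \<open>For such \<open>m\<close> the sum coloring witnesses that a surjective
        coloring exists.\<close>
      using eventually_ge_at_top[of "2 * r"]
    proof eventually_elim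
      case (elim m)
      then show ?case
        unfolding max_rainbow_density_def card_copies_complete_graph
        using max_rainbow_le_max_rainbow_le[OF coloring_sum_mod[OF assms(1), of "m + ?k"], of t]
        by (intro divide_right_mono) simp_all
    qed
  qed
  then have "?d \<longlonglongrightarrow> L" by (rule LIMSEQ_offset)
  then show ?thesis by (rule convergentI)
qed

section \<open>Comparison with the uniformly random coloring\<close>

text \<open>The quotient is the product of \<open>1 - i/r\<close> over \<open>i < e\<close>. The
  bound follows by induction, each new factor compensating the growth of \<open>e choose 2\<close>
  by \<open>e\<close>.\<close>

lemma random_rainbow_density_le:
  assumes "r \<ge> 1"
  shows "real (r choose e) * fact e / real r ^ e * (real r + real (e choose 2)) \<le> real r"
proof (induction e)
  case (Suc e)
  let ?P = "\<lambda>e. real (r choose e) * fact e / real r ^ e"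
  have "Suc e * (r choose Suc e) = (r - e) * (r choose e)"
    using binomial_absorption[of e r] binomial_absorb_comp[of r e] by simp
  then have eq: "real (Suc e) * real (r choose Suc e) = real (r - e) * real (r choose e)"
    by (metis of_nat_mult)
  have "?P (Suc e) = fact e * (real (Suc e) * real (r choose Suc e)) / real r ^ Suc e"
    by (simp only: fact_Suc of_nat_mult mult_ac)
  also have "\<dots> = ?P e * (real (r - e) / real r)"
    unfolding eq by (simp add: mult_ac)
  finally have P: "?P (Suc e) = ?P e * (real (r - e) / real r)" .
  \<comment> \<open>For \<open>e \<le> r\<close> the cleared inequality has slack
    \<open>e * (Suc e choose 2)\<close>. For \<open>e > r\<close> the next binomial coefficient
    vanishes.\<close>
  show ?case
  proof (cases "e \<le> r")
    case True
    have "real (r - e) * (real r + real (Suc e choose 2)) \<le> real r * (real r + real (e choose 2))"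
      using True by (simp add: of_nat_diff numeral_2_eq_2 algebra_simps)
    then have "real (r - e) / real r * (real r + real (Suc e choose 2)) \<le> real r + real (e choose 2)"
      using assms by (simp add: field_simps)
    then have "?P e * (real (r - e) / real r * (real r + real (Suc e choose 2)))
        \<le> ?P e * (real r + real (e choose 2))"
      by (rule mult_left_mono) simp
    with Suc P show ?thesis by (simp add: mult.assoc)
  qed (simp add: binomial_eq_0)
qed (use assms in simp)

theorem theorem8:
  fixes t :: nat
  assumes "t \<ge> 4"
  shows "\<exists>r\<^sub>t \<ge> t choose 2. \<forall>r \<ge> r\<^sub>t. rainbow_uncommon r (complete_graph t)"
proof -
  define s where "s = (t choose 2) choose 2"
  have "4 * 3 \<le> t * (t - 1)" using assms by (intro mult_le_mono) auto
  then have "2 \<le> t choose 2" by (simp add: choose_two)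
  then have s: "s \<ge> 1" by (simp add: s_def Suc_le_eq)
  \<comment> \<open>The first summand secures the required
    \<open>r\<^sub>t \<ge> t choose 2\<close>; the second contradicts the final inequality
    \<open>r + s \<le> s * s\<close>.\<close>
  have "rainbow_uncommon r (complete_graph t)" if r: "r \<ge> (t choose 2) + s * s" for r
    unfolding rainbow_uncommon_def rainbow_common_def card_edges_complete_graph
  proof
    let ?d = "\<lambda>n. max_rainbow_density (complete_graph t) n r"
    let ?P = "real (r choose (t choose 2)) * fact (t choose 2) / real r ^ (t choose 2)"
    assume eq: "limit_rainbow_density (complete_graph t) r = ?P"
    have r1: "r \<ge> 1" using r \<open>2 \<le> t choose 2\<close> by simp
    \<comment> \<open>Proved convergence is what turns the value of \<open>lim\<close> into an
      actual limit.\<close>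
    have "?d \<longlonglongrightarrow> ?P"
      using max_rainbow_density_convergent[OF r1, of t] assms eq
      by (simp add: convergent_LIMSEQ_iff limit_rainbow_density_def)
    moreover have "(\<lambda>n. 1 - (real s - 1) * (1 / real r + 1 / real n))
        \<longlonglongrightarrow> 1 - (real s - 1) * (1 / real r + 0)"
      by (intro tendsto_intros lim_1_over_n)
    moreover have "1 - (real s - 1) * (1 / real r + 1 / real n) \<le> ?d n" if "n \<ge> 2 * r + t" for n
      using max_rainbow_density_ge[OF assms r1, of n] that by (simp add: s_def)
    ultimately have "1 - (real s - 1) * (1 / real r + 0) \<le> ?P"
      by (meson LIMSEQ_le)
    then have "(1 - (real s - 1) / real r) * (real r + real s) \<le> ?P * (real r + real s)"
      by (intro mult_right_mono) simp_all
    also have "\<dots> \<le> real r"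
      unfolding s_def by (rule random_rainbow_density_le[OF r1])
    finally have "(real r - (real s - 1)) * (real r + real s) \<le> real r * real r"
      using r1 by (simp add: field_simps)
    \<comment> \<open>The left product expands to \<open>r * r + r + s - s * s\<close>, and the
      quadratic terms in \<open>r\<close> cancel. Saving one collision event leaves the linear term
      \<open>r\<close>.\<close>
    then have "real r + real s \<le> real s * real s" by (simp add: algebra_simps)
    then have "real (r + s) \<le> real (s * s)" by simp
    then have "r + s \<le> s * s" by (simp only: of_nat_le_iff)
    with r s show False by simp
  qed
  then show ?thesis by (intro exI[of _ "(t choose 2) + s * s"]) simp
qed

end
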